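(* Let $q=3$, let $m\ge 4$ be even, and let $n=(3^m-1)/2$. Then $\mathcal{C}_{(1,n)}$ is a ternary negacyclic self-dual code (that is, $\mathcal{C}_{(1,n)}^\perp=\mathcal{C}_{(1,n)}$) of length $(3^m-1)/2$, dimension $(3^m-1)/4$, and minimum distance $d\ge d_m$, where $$d_m=\begin{cases}3^{(m-2)/2}+3 & \text{if } m\equiv 2 \pmod 4,\\ [3^{(m-2)/2}+15]/2 & \text{if } m\equiv 0\pmod 4.\end{cases}$$
   Context: Let $q=3$, $m\ge 2$ an integer, $N=3^m-1$, $n=N/2$. For $0\le h\le 3^m-1$ with $3$-adic expansion $h=\sum_{j=0}^{m-1}h_j3^j$, $0\le h_j\le 2$, let $\mathtt{wt}(h)$ be the number of indices $j$ with $h_j\ne 0$. Let $\Omega=\{1+2i: 0\le i\le n-1\}$ (the odd residues modulo $N$) and let $T_{(1,n)}=\{h\in\Omega: \mathtt{wt}(h)\equiv 1 \pmod 2\}$; this set is closed under multiplication by $3$ modulo $N$. A linear code of length $n$ over $\mathrm{GF}(3)$ is identified with a subspace of $\mathrm{GF}(3)[x]/(x^n+1)$ via $(c_0,\dots,c_{n-1})\mapsto \sum_j c_jx^j$; it is negacyclic if it is an ideal there, and its generator polynomial is then the monic divisor of $x^n+1$ generating it. Fix a primitive element $\beta$ of $\mathrm{GF}(3^m)$, so $\beta^n=-1$ and the roots of $x^n+1$ are $\beta^i$, $i\in\Omega$. $\mathcal{C}_{(1,n)}$ is the negacyclic code of length $n$ over $\mathrm{GF}(3)$ with defining set $T_{(1,n)}$,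 i.e. with generator polynomial $\prod_{i\in T_{(1,n)}}(x-\beta^i)$. Minimum distance is Hamming distance, and duality is with respect to the standard (Euclidean) inner product on $\mathrm{GF}(3)^n$. *)

theory Defs
  imports "Jordan_Normal_Form.VS_Connect" "HOL-Algebra.Ideal" "HOL-Library.Cardinality"
begin

(* Digits with index j >= m vanish for h < 3^m, so m only bounds the index range. *)
definition wt :: "nat \<Rightarrow> nat \<Rightarrow> nat" where
  "wt m h = card {j. j < m \<and> (h div 3 ^ j) mod 3 \<noteq> 0}"

definition len :: "nat \<Rightarrow> nat" where
  "len m = (3 ^ m - 1) div 2"

definition Omega :: "nat \<Rightarrow> nat set" where
  "Omega m = {1 + 2 * i | i. i < len m}"

definition T1 :: "nat \<Rightarrow> nat set" where
  "T1 m = {h \<in> Omega m. wt m h mod 2 = 1}"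

definition primitive_element :: "'k::field \<Rightarrow> bool" where
  "primitive_element \<beta> \<longleftrightarrow> range (\<lambda>k::nat. \<beta> ^ k) = UNIV - {0}"

(* x^n + 1 *)
definition nega_mod :: "nat \<Rightarrow> 'f::field poly" where
  "nega_mod n = monom 1 n + 1"

(* The quotient ring F[x]/(x^n+1), n >= 1, on the representatives of degree < n. *)
definition nega_ring :: "nat \<Rightarrow> 'f::field poly ring" where
  "nega_ring n = \<lparr>carrier = {p. degree p < n}, monoid.mult = (\<lambda>p q. (p * q) mod nega_mod n),
     one = 1, zero = 0, add = (+)\<rparr>"

definition word_poly :: "'f::field vec \<Rightarrow> 'f poly" where
  "word_poly c = (\<Sum>j<dim_vec c. monom (c $ j) j)"

definition linear_code :: "nat \<Rightarrow> 'f::field vec set \<Rightarrow> bool" where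
  "linear_code n C \<longleftrightarrow> VectorSpace.subspace class_ring C (module_vec TYPE('f) n)"

definition code_dim :: "nat \<Rightarrow> 'f::field vec set \<Rightarrow> nat" where
  "code_dim n C = vectorspace.dim class_ring ((module_vec TYPE('f) n)\<lparr>carrier := C\<rparr>)"

definition negacyclic :: "nat \<Rightarrow> 'f::field vec set \<Rightarrow> bool" where
  "negacyclic n C \<longleftrightarrow> linear_code n C \<and> ideal (word_poly ` C) (nega_ring n)"

definition dual_code :: "nat \<Rightarrow> 'f::field vec set \<Rightarrow> 'f vec set" where
  "dual_code n C = {u \<in> carrier_vec n. \<forall>v\<in>C. u \<bullet> v = 0}"

definition hamming_dist :: "'f vec \<Rightarrow> 'f vec \<Rightarrow> nat" where
  "hamming_dist u v = card {i. i < dim_vec u \<and> u $ i \<noteq> v $ i}"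

definition min_dist :: "'f vec set \<Rightarrow> nat" where
  "min_dist C = Inf {hamming_dist u v | u v. u \<in> C \<and> v \<in> C \<and> u \<noteq> v}"

(* phi embeds the ground field F into the field containing beta; the product is required
   to descend to F[x], which it does when T is closed under multiplication by |F|. *)
definition generator_poly :: "('f::field \<Rightarrow> 'k::field) \<Rightarrow> 'k \<Rightarrow> nat set \<Rightarrow> 'f poly" where
  "generator_poly \<phi> \<beta> T = (THE g. map_poly \<phi> g = (\<Prod>i\<in>T. [:- (\<beta> ^ i), 1:]))"

(* The reduction only matters for g = x^n + 1, whose class is 0. *)
definition code_of_generator :: "nat \<Rightarrow> 'f::field poly \<Rightarrow> 'f vec set" where
  "code_of_generator n g =
     {c \<in> carrier_vec n. word_poly c \<in> PIdl\<^bsub>nega_ring n\<^esub> (g mod nega_mod n)}"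

definition code_C1 :: "nat \<Rightarrow> ('f::field \<Rightarrow> 'k::field) \<Rightarrow> 'k \<Rightarrow> 'f vec set" where
  "code_C1 m \<phi> \<beta> = code_of_generator (len m) (generator_poly \<phi> \<beta> (T1 m))"

definition d_bound :: "nat \<Rightarrow> real" where
  "d_bound m = (if m mod 4 = 2 then 3 ^ ((m - 2) div 2) + 3
                else (3 ^ ((m - 2) div 2) + 15) / 2)"

end

theory Submission
  imports Defs "Jordan_Normal_Form.Char_Poly"
begin

text \<open>Write \<open>N = 3\<^sup>m - 1 = 2n\<close>. For odd \<open>h\<close> the weights of \<open>h\<close> and \<open>N - h\<close> have opposite parity (\<open>m\<close> is
  even), so the defining set \<open>T\<close> and \<open>N - T\<close> partition the odd residues. Parseval's identity then
  makes the code self-orthogonal, and since it has dimension \<open>n/2\<close> it is self-dual. In particular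
  all its weights are divisible by \<open>3\<close>.

  With \<open>m = 2k + 2\<close>, the numbers \<open>3\<^sup>2\<^sup>k + i (3\<^sup>k + 1)\<close> for \<open>i < 3\<^sup>k\<close> have ternary digits \<open>0 1 i i\<close> in blocks of
  length \<open>1, 1, k, k\<close>, hence odd weight, and form a progression of length \<open>3\<^sup>k\<close> in \<open>T\<close>. The greatest
  common divisor of the step and \<open>N\<close> divides \<open>4\<close>, so the associated locators separate positions up
  to a shift by \<open>n/2\<close>; this ambiguity is harmless over the field of three elements, and the BCH
  argument gives weight at least \<open>3\<^sup>k + 1\<close>, hence \<open>3\<^sup>k + 3\<close>. This suffices for all \<open>m\<close> except \<open>m = 4\<close>,
  where a progression of length \<open>8\<close> with step \<open>14\<close>, found by search, gives weight at least \<open>9\<close>.\<close>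

subsection \<open>Ternary weights and the defining set\<close>

text \<open>Since \<open>y < 3 ^ b\<close> there is no carry: the digits of \<open>y\<close> and
  \<open>x\<close> sit side by side, so weights add over blocks.\<close>

lemma wt_split:
  assumes "y < 3 ^ b"
  shows "wt (b + a) (x * 3 ^ b + y) = wt b y + wt a x"
proof -
  let ?h = "x * 3 ^ b + y"
  have lo: "(?h div 3 ^ j) mod 3 = (y div 3 ^ j) mod 3" if "j < b" for j
  proof -
    obtain c where c: "b = Suc (j + c)" using \<open>j < b\<close> less_iff_Suc_add by blast
    have e: "x * 3 ^ b = 3 ^ j * (3 * (3 ^ c * x))" by (simp add: c power_add)
    have "?h div 3 ^ j = 3 * (3 ^ c * x) + y div 3 ^ j"
      unfolding e by simp
    then show ?thesis by simp
  qed
  have hi: "?h div 3 ^ (b + j) = x div 3 ^ j" for j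
    using assms by (simp add: power_add div_mult2_eq)
  have "{j. j < b + a \<and> (?h div 3 ^ j) mod 3 \<noteq> 0} =
     {j. j < b \<and> (y div 3 ^ j) mod 3 \<noteq> 0} \<union> (+) b ` {j. j < a \<and> (x div 3 ^ j) mod 3 \<noteq> 0}"
    (is "_ = ?A \<union> ?B")
  proof (rule Set.set_eqI)
    fix j show "j \<in> {j. j < b + a \<and> (?h div 3 ^ j) mod 3 \<noteq> 0} \<longleftrightarrow> j \<in> ?A \<union> ?B"
    proof (cases "j < b")
      case True then show ?thesis using lo by auto
    next
      case False
      then obtain i where "j = b + i" using le_Suc_ex by (auto simp: not_less)
      then show ?thesis using hi by auto
    qed
  qed
  moreover have "?A \<inter> ?B = {}" by auto
  moreover have "finite ?A" "finite ?B" by auto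
  ultimately show ?thesis unfolding wt_def
    by (simp add: card_Un_disjoint card_image)
qed

lemma wt_one_digit: "t < 3 \<Longrightarrow> wt 1 t = (if t = 0 then 0 else 1)"
proof -
  assume "t < 3"
  then have "{j. j < 1 \<and> (t div 3 ^ j) mod 3 \<noteq> 0} = (if t = 0 then {} else {0})"
    by auto
  then show ?thesis by (simp add: wt_def)
qed

lemma wt_Suc: "wt (Suc m) h = wt m (h div 3) + (if h mod 3 = 0 then 0 else 1)"
  using wt_split[of "h mod 3" 1 m "h div 3"] wt_one_digit[of "h mod 3"] by simp

lemma wt_Suc_top:
  assumes "y < 3 ^ m" "t < 3"
  shows "wt (Suc m) (t * 3 ^ m + y) = wt m y + (if t = 0 then 0 else 1)"
  using wt_split[of y m 1 t] wt_one_digit[of t] assms by simp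

text \<open>Complementing replaces each digit \<open>r\<close> by \<open>2 - r\<close> without
  borrows. A digit 0 or 2 contributes 1 to the two weights together and a digit 1 contributes 2, so
  their sum is \<open>m\<close> plus the number of ones. That number has the parity of
  \<open>h\<close>, all powers of 3 being odd.\<close>

lemma even_wt_complement:
  "h < 3 ^ m \<Longrightarrow> even (wt m h + wt m (3 ^ m - 1 - h) + m + h)"
proof (induction m arbitrary: h)
  case 0
  then show ?case by (simp add: wt_def)
next
  case (Suc m)
  define q r where "q = h div 3" and "r = h mod 3"
  have h: "h = 3 * q + r" and r: "r < 3" by (auto simp: q_def r_def)
  have q: "q < 3 ^ m" using Suc.prems by (auto simp: q_def)
  have c: "3 ^ Suc m - 1 - h = 3 * (3 ^ m - 1 - q) + (2 - r)"
    using q r h by simp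
  have "(3 ^ Suc m - 1 - h) div 3 = 3 ^ m - 1 - q" "(3 ^ Suc m - 1 - h) mod 3 = 2 - r"
    unfolding c by simp_all
  then have "wt (Suc m) (3 ^ Suc m - 1 - h) = wt m (3 ^ m - 1 - q) + (if r = 2 then 0 else 1)"
    using r by (simp add: wt_Suc)
  moreover have "wt (Suc m) h = wt m q + (if r = 0 then 0 else 1)"
    by (simp add: wt_Suc q_def r_def)
  moreover have "r = 0 \<or> r = 1 \<or> r = 2" using r by auto
  ultimately show ?case using Suc.IH[OF q] by (auto simp: h)
qed

lemma two_len: "2 * len m = 3 ^ m - 1"
  by (simp add: len_def)

lemma Omega_eq: "Omega m = {h. odd h \<and> h < 3 ^ m - 1}"
proof -
  have "h \<in> Omega m \<longleftrightarrow> odd h \<and> h < 2 * len m" for h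
    by (auto simp: Omega_def elim!: oddE)
  then show ?thesis by (auto simp: two_len)
qed

lemma T1_eq: "T1 m = {h. odd h \<and> h < 3 ^ m - 1 \<and> odd (wt m h)}"
  unfolding T1_def Omega_eq odd_iff_mod_2_eq_one by auto

lemma finite_Omega: "finite (Omega m)"
  by (simp add: Omega_def)

lemma finite_T1: "finite (T1 m)"
  using finite_Omega by (rule finite_subset[rotated]) (auto simp: T1_def)

lemma card_Omega: "card (Omega m) = len m"
proof -
  have "Omega m = (\<lambda>i. 1 + 2 * i) ` {..<len m}" by (auto simp: Omega_def)
  then show ?thesis by (simp add: card_image inj_on_def)
qed

lemma complement_T1:
  assumes "even m" "h \<in> Omega m"
  shows "3 ^ m - 1 - h \<in> T1 m \<longleftrightarrow> h \<notin> T1 m"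
proof -
  have h: "odd h" "h < 3 ^ m - 1" using assms by (auto simp: Omega_eq)
  then have "0 < h" by (auto intro: Nat.gr0I)
  have "3 ^ m - 1 - h \<in> Omega m"
    using h \<open>0 < h\<close> by (auto simp: Omega_eq)
  moreover have "even (wt m h + wt m (3 ^ m - 1 - h) + m + h)"
    using h by (intro even_wt_complement) auto
  ultimately show ?thesis using assms h by (auto simp: T1_eq Omega_eq)
qed

lemma two_card_T1:
  assumes "even m"
  shows "2 * card (T1 m) = len m"
proof -
  let ?c = "\<lambda>h. 3 ^ m - 1 - h"
  have sub: "T1 m \<subseteq> Omega m" by (auto simp: T1_def)
  have inv: "?c (?c h) = h" "?c h \<in> Omega m" if "h \<in> Omega m" for h
    using that odd_pos[of h] by (auto simp: Omega_eq)
  have "bij_betw ?c (T1 m) (Omega m - T1 m)"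
  proof (rule bij_betw_byWitness[where f' = ?c])
    show "?c ` T1 m \<subseteq> Omega m - T1 m" using assms sub inv complement_T1 by blast
    show "?c ` (Omega m - T1 m) \<subseteq> T1 m" using assms complement_T1 by blast
  qed (use sub inv in blast)+
  then have "card (T1 m) = card (Omega m - T1 m)" by (rule bij_betw_same_card)
  then show ?thesis
    using card_Diff_subset[OF finite_T1 sub] card_mono[OF finite_Omega sub] card_Omega[of m] by simp
qed

text \<open>Tripling modulo \<open>3 ^ m - 1\<close> rotates the \<open>m\<close> digits cyclically:
  the leading digit \<open>t\<close> becomes the last one, and the weight is unchanged.\<close>

lemma triple_mod_T1:
  assumes "0 < m" "h \<in> T1 m"
  shows "(3 * h) mod (3 ^ m - 1) \<in> T1 m"
proof -
  obtain k where k: "m = Suc k" using assms(1) gr0_conv_Suc by auto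
  define t y where "t = h div 3 ^ k" and "y = h mod 3 ^ k"
  have h: "h = t * 3 ^ k + y" and y: "y < 3 ^ k" by (simp_all add: t_def y_def div_mult_mod_eq)
  have hlt: "h < 3 ^ m - 1" "odd h" "odd (wt m h)"
    using assms by (auto simp: T1_def Omega_eq)
  have t: "t < 3" using hlt(1) by (simp add: t_def k less_mult_imp_div_less)
  \<comment> \<open>All digits equal to 2 would mean \<open>h = 3 ^ m - 1\<close>; only then would
    the rotated number fail to be reduced.\<close>
  have ne: "\<not> (t = 2 \<and> y = 3 ^ k - 1)"
    using hlt(1) by (auto simp: h k)
  have 3: "3 * h = t * (3 ^ m - 1) + (3 * y + t)"
  proof -
    have "t * 3 ^ m = t * (3 ^ m - 1) + t" by (simp add: diff_mult_distrib2)
    then show ?thesis by (simp add: h k)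
  qed
  have lt: "3 * y + t < 3 ^ m - 1"
  proof -
    have "3 * y + t + 1 < 3 * 3 ^ k"
      using t y ne one_le_power[of "3::nat" k] by linarith
    then show ?thesis by (simp add: k)
  qed
  have eq: "(3 * h) mod (3 ^ m - 1) = 3 * y + t"
    unfolding 3 using lt by simp
  have "wt m (3 * y + t) = wt k y + (if t = 0 then 0 else 1)"
    using t by (simp add: k wt_Suc)
  also have "\<dots> = wt m h"
    using wt_Suc_top[OF y t] by (simp add: h k)
  finally have "odd (wt m (3 * y + t))" using hlt by simp
  moreover have "odd (3 * y + t)" using hlt(2) by (auto simp: h)
  ultimately show ?thesis
    unfolding eq using lt by (simp add: T1_eq)
qed

text \<open>Multiplication by \<open>3 ^ (m - 1)\<close> inverts tripling, because
  \<open>3 ^ m\<close> is 1 modulo \<open>3 ^ m - 1\<close>.\<close>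

lemma inj_on_triple_mod: "inj_on (\<lambda>h. (3 * h) mod (3 ^ m - 1 :: nat)) {..<3 ^ m - 1}"
proof (rule inj_onI)
  fix a b :: nat
  assume ab: "a \<in> {..<3 ^ m - 1}" "b \<in> {..<3 ^ m - 1}" "(3 * a) mod (3 ^ m - 1) = (3 * b) mod (3 ^ m - 1)"
  have inv: "((3 * c) mod (3 ^ m - 1) * 3 ^ (m - 1)) mod (3 ^ m - 1) = c"
    if "c \<in> {..<3 ^ m - 1 :: nat}" for c
  proof -
    have "0 < m" using that by (auto intro: Nat.gr0I)
    then have "3 * c * 3 ^ (m - 1) = c * (3 * 3 ^ (m - 1))" by simp
    also have "3 * 3 ^ (m - 1) = (3::nat) ^ m" using \<open>0 < m\<close> by (simp flip: power_Suc)
    also have "c * 3 ^ m = c + c * (3 ^ m - 1)" by (simp add: algebra_simps)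
    finally show ?thesis using that by (simp add: mod_mult_left_eq)
  qed
  have "a = ((3 * a) mod (3 ^ m - 1) * 3 ^ (m - 1)) mod (3 ^ m - 1)" using inv[OF ab(1)] by (rule sym)
  also have "\<dots> = b" unfolding ab(3) by (rule inv[OF ab(2)])
  finally show "a = b" .
qed

text \<open>Multiplying by \<open>3 ^ k + 1\<close> writes the block \<open>y\<close> twice, an even
  contribution to the weight; the digit 1 at position \<open>2 * k\<close> makes it odd.\<close>

lemma T1_progression:
  assumes "m = 2 * k + 2" "y < 3 ^ k"
  shows "3 ^ (2 * k) + y * (3 ^ k + 1) \<in> T1 m"
proof -
  have "wt (k + 2) (1 * 3 ^ k + y) = wt k y + wt 2 1"
    using wt_split[of y k 2 1] assms by simp
  moreover have "wt 2 1 = 1"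
    using wt_Suc[of 1 1] wt_one_digit[of 0] wt_one_digit[of 1] by (simp add: numeral_2_eq_2)
  moreover have "wt m ((1 * 3 ^ k + y) * 3 ^ k + y) = wt k y + wt (k + 2) (1 * 3 ^ k + y)"
    using wt_split[of y k "k + 2" "1 * 3 ^ k + y"] assms by (simp add: mult_2)
  moreover have "3 ^ (2 * k) + y * (3 ^ k + 1) = (1 * 3 ^ k + y) * 3 ^ k + y"
    by (simp add: algebra_simps power_add[symmetric] mult_2)
  ultimately have "wt m (3 ^ (2 * k) + y * (3 ^ k + 1)) = 2 * wt k y + 1"
    by (simp only: mult_2)
  then have "odd (wt m (3 ^ (2 * k) + y * (3 ^ k + 1)))" by simp
  moreover have "3 ^ (2 * k) + y * (3 ^ k + 1) < 3 ^ m - 1"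
  proof -
    have "y * (3 ^ k + 1) < 3 ^ k * (3 ^ k + 1)"
      using assms by (intro mult_strict_right_mono) auto
    also have "\<dots> \<le> 2 * 3 ^ (2 * k)" by (simp add: algebra_simps mult_2_right power_add)
    finally show ?thesis using one_le_power[of "3::nat" "2 * k"] by (simp add: assms(1) power_add)
  qed
  ultimately show ?thesis by (simp add: T1_eq)
qed

text \<open>For \<open>m = 4\<close> the general progression has three terms and yields only weight
  6, whereas \<open>d_bound 4\<close> is 9. Here 80 is \<open>3 ^ 4 - 1\<close>.\<close>

lemma T1_4_progression:
  assumes "i < 8"
  shows "(47 + i * 14) mod 80 \<in> T1 4"
proof -
  let ?d = "\<lambda>h :: nat. if h mod 3 = 0 then 0 else 1 :: nat"
  have e: "Suc 3 = 4" "Suc 2 = 3" "Suc 1 = 2" by simp_all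
  have "wt 4 h = wt 3 (h div 3) + ?d h" "wt 3 h = wt 2 (h div 3) + ?d h"
       "wt 2 h = wt 1 (h div 3) + ?d h" "wt 1 h = ?d h" for h
    using wt_Suc[of 3 h, unfolded e] wt_Suc[of 2 h, unfolded e] wt_Suc[of 1 h, unfolded e]
      wt_Suc[of 0 h] by (simp_all add: wt_def[of 0])
  then have wt4: "wt 4 h = ?d (h div 3 div 3 div 3) + ?d (h div 3 div 3) + ?d (h div 3) + ?d h" for h
    by (simp only:)
  have "i = 0 \<or> i = 1 \<or> i = 2 \<or> i = 3 \<or> i = 4 \<or> i = 5 \<or> i = 6 \<or> i = 7"
    using assms by linarith
  then show ?thesis
    by (elim disjE) (simp_all add: T1_eq wt4)
qed

subsection \<open>The fields of order \<open>3\<close> and \<open>3\<^sup>m\<close>\<close>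

text \<open>Translation by 1 permutes the ring, so it preserves the sum of all elements while adding
  the cardinality to it.\<close>

lemma of_nat_CARD_eq_0:
  assumes "finite (UNIV :: 'a::ring_1 set)"
  shows "(of_nat CARD('a) :: 'a) = 0"
proof -
  have "(\<Sum>x\<in>UNIV. x) = (\<Sum>x\<in>UNIV. x + 1 :: 'a)"
    by (rule sum.reindex_bij_betw[symmetric]) (auto intro: bij_betw_byWitness[where f' = "\<lambda>x. x - 1"])
  also have "\<dots> = (\<Sum>x\<in>UNIV. x) + of_nat CARD('a)" by (simp add: sum.distrib)
  finally show ?thesis by simp
qed

lemma cube_add_char3:
  fixes x y :: "'a::comm_ring_1"
  assumes "(3 :: 'a) = 0"
  shows "(x + y) ^ 3 = x ^ 3 + y ^ 3"
proof -
  have "(x + y) ^ 3 = x ^ 3 + y ^ 3 + 3 * (x\<^sup>2 * y + x * y\<^sup>2)"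
    by (simp add: power3_eq_cube power2_eq_square algebra_simps)
  then show ?thesis by (simp add: assms)
qed

lemma one_neq_minus_one_char3: "(1 :: 'a::field) \<noteq> - 1" if "(3 :: 'a) = 0"
proof
  assume "(1 :: 'a) = - 1"
  then have "(1 :: 'a) + 1 = 0" by (metis add.left_inverse)
  then have "(3 :: 'a) = 1" using numeral_plus_one[of "num.Bit0 num.One", where 'a = 'a] by simp
  with that show False by simp
qed

section \<open>The order of a primitive element\<close>

context
  fixes \<beta> :: "'k::field" and N :: nat
  assumes prim: "primitive_element \<beta>" and card: "CARD('k) = N + 1" and N: "0 < N"
begin

lemma primitive_element_nonzero: "\<beta> \<noteq> 0"
proof -
  have "\<beta> ^ 1 \<in> UNIV - {0}" using prim unfolding primitive_element_def by blast
  then show ?thesis by simp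
qed

text \<open>Finiteness makes two powers coincide, so a least positive exponent \<open>d\<close> with
  \<open>\<beta> ^ d = 1\<close> exists. The \<open>d\<close> powers below it are distinct and
  exhaust the nonzero elements, whence \<open>d = N\<close>.\<close>

lemma primitive_element_order:
  shows "\<beta> ^ N = 1" and "inj_on ((^) \<beta>) {..<N}"
proof -
  have fin: "finite (UNIV :: 'k set)" using card card_ge_0_finite[of "UNIV :: 'k set"] by simp
  have "\<not> inj ((^) \<beta>)"
    using finite_imageD[of "(^) \<beta>" UNIV] fin finite_subset[OF subset_UNIV] by blast
  then obtain a b where "a < b" "\<beta> ^ a = \<beta> ^ b"
    unfolding inj_def by (metis linorder_neqE_nat)
  then have "\<beta> ^ a * \<beta> ^ (b - a) = \<beta> ^ a * 1"
    by (metis le_add_diff_inverse less_imp_le mult.right_neutral power_add)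
  then have ex: "0 < b - a \<and> \<beta> ^ (b - a) = 1" using \<open>a < b\<close> primitive_element_nonzero by simp
  define d where "d = (LEAST d. 0 < d \<and> \<beta> ^ d = 1)"
  have d: "0 < d" "\<beta> ^ d = 1" using LeastI[of "\<lambda>d. 0 < d \<and> \<beta> ^ d = 1", OF ex] by (auto simp: d_def)
  have min: "d \<le> e" if "0 < e" "\<beta> ^ e = 1" for e
    unfolding d_def using that by (intro Least_le) auto
  have red: "\<beta> ^ i = \<beta> ^ (i mod d)" for i
    using d(2) by (metis power_add power_mult power_one mult_1 mult_div_mod_eq)
  have inj: "inj_on ((^) \<beta>) {..<d}"
  proof (rule linorder_inj_onI)
    fix i j assume ij: "i < j" "i \<in> {..<d}" "j \<in> {..<d}"
    show "\<beta> ^ i \<noteq> \<beta> ^ j"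
    proof
      assume "\<beta> ^ i = \<beta> ^ j"
      then have "\<beta> ^ i * \<beta> ^ (j - i) = \<beta> ^ i * 1"
        using ij by (metis le_add_diff_inverse less_imp_le mult.right_neutral power_add)
      then have "\<beta> ^ (j - i) = 1" using primitive_element_nonzero by simp
      then have "d \<le> j - i" using ij by (intro min) auto
      then show False using ij by auto
    qed
  qed auto
  have "UNIV - {0} = (^) \<beta> ` {..<d}"
  proof -
    have "range ((^) \<beta>) \<subseteq> (^) \<beta> ` {..<d}" using red d(1) by fastforce
    then show ?thesis using prim unfolding primitive_element_def by auto
  qed
  then have "card (UNIV - {0 :: 'k}) = d" using inj by (simp add: card_image)
  then have "d = N" using card fin by (simp add: card_Diff_subset)
  then show "\<beta> ^ N = 1" "inj_on ((^) \<beta>) {..<N}" using d inj by auto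
qed

lemma primitive_element_pow_mod: "\<beta> ^ (i mod N) = \<beta> ^ i"
  using primitive_element_order(1) by (metis power_add power_mult power_one mult_1 mult_div_mod_eq)

lemma primitive_element_pow_eq_1_iff: "\<beta> ^ i = 1 \<longleftrightarrow> N dvd i"
proof
  assume "\<beta> ^ i = 1"
  then have "\<beta> ^ (i mod N) = \<beta> ^ 0" by (simp add: primitive_element_pow_mod)
  then have "i mod N = 0" using inj_onD[OF primitive_element_order(2)] N by fastforce
  then show "N dvd i" by auto
next
  assume "N dvd i"
  then show "\<beta> ^ i = 1" using primitive_element_pow_mod[of i] by (metis mod_0_imp_dvd dvd_imp_mod_0 power_0)
qed

end

locale negacyclic_C1 =
  fixes m :: nat and \<phi> :: "'f::field \<Rightarrow> 'k::field" and \<beta> :: 'k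
  assumes card_f: "CARD('f) = 3" and card_k: "CARD('k) = 3 ^ m"
    and field_hom: "field_hom \<phi>" and prim: "primitive_element \<beta>"
    and m_ge_4: "4 \<le> m" and even_m: "even m"
begin

abbreviation "N \<equiv> (3 :: nat) ^ m - 1"
abbreviation "n \<equiv> len m"

sublocale field_hom \<phi> by (rule field_hom)
sublocale map_poly_hom: map_poly_inj_idom_hom \<phi> ..

lemma N_pos: "0 < N"
  using m_ge_4 one_less_power[of "3 :: nat" m] by simp

lemma card_k': "CARD('k) = N + 1"
  by (simp add: card_k)

lemmas beta_nonzero = primitive_element_nonzero[OF prim card_k' N_pos]
lemmas beta_N = primitive_element_order(1)[OF prim card_k' N_pos]
lemmas beta_inj = primitive_element_order(2)[OF prim card_k' N_pos]
lemmas beta_pow_mod = primitive_element_pow_mod[OF prim card_k' N_pos]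
lemmas beta_pow_eq_1_iff = primitive_element_pow_eq_1_iff[OF prim card_k' N_pos]

lemma finite_f: "finite (UNIV :: 'f set)"
  using card_f card_ge_0_finite[of "UNIV :: 'f set"] by simp

lemma three_f: "(3 :: 'f) = 0"
  using of_nat_CARD_eq_0[OF finite_f] by (simp add: card_f)

lemma three_k: "(3 :: 'k) = 0"
  using arg_cong[OF three_f, of \<phi>] by (simp add: hom_numeral)

lemma UNIV_f: "(UNIV :: 'f set) = {0, 1, -1}"
proof -
  have "card {0, 1, -1 :: 'f} = 3" using one_neq_minus_one_char3[OF three_f] by simp
  then show ?thesis using card_subset_eq[OF finite_f, of "{0, 1, -1}"] by (simp add: card_f)
qed

lemma f_cases: "x = 0 \<or> x = 1 \<or> x = (-1 :: 'f)"
  using UNIV_f by auto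

text \<open>This makes \<open>c \<bullet> c\<close> the weight of \<open>c\<close> modulo 3, and it
  is also the reason why -1 is not a square in the ground field.\<close>

lemma f_square: "x * x = (if x = 0 then 0 else 1 :: 'f)"
  using f_cases[of x] by auto

lemma of_nat_f_eq_0: "of_nat i = (0 :: 'f) \<Longrightarrow> 3 dvd i"
proof -
  assume i: "of_nat i = (0 :: 'f)"
  have "of_nat i = (of_nat (i mod 3) + 3 * of_nat (i div 3) :: 'f)"
    by (metis mod_mult_div_eq of_nat_add of_nat_mult of_nat_numeral)
  then have r: "of_nat (i mod 3) = (0 :: 'f)" using i three_f by simp
  have "(2 :: 'f) \<noteq> 0" using one_neq_minus_one_char3[OF three_f]
    by (metis one_add_one add_eq_0_iff)
  have "i mod 3 = 0 \<or> i mod 3 = 1 \<or> i mod 3 = 2" by linarith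
  then show "3 dvd i" using r \<open>(2 :: 'f) \<noteq> 0\<close> by auto
qed

text \<open>The polynomial \<open>x ^ 3 - x\<close> splits with roots 0, 1, -1, all coming from the
  ground field. This is the descent criterion for the coefficients of the generator.\<close>

lemma cube_fixed_in_range: "x ^ 3 = x \<Longrightarrow> x \<in> range \<phi>"
proof -
  assume "x ^ 3 = x"
  then have "x * (x - 1) * (x + 1) = 0" by (simp add: power3_eq_cube algebra_simps)
  then have "x = \<phi> 0 \<or> x = \<phi> 1 \<or> x = \<phi> (-1)" by (auto simp: hom_uminus eq_neg_iff_add_eq_0)
  then show ?thesis by auto
qed

lemma beta_len: "\<beta> ^ n = -1"
proof -
  have "(\<beta> ^ n)\<^sup>2 = 1" using beta_N by (simp add: power_mult[symmetric] mult.commute[of n] two_len)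
  moreover have "\<beta> ^ n \<noteq> 1"
    unfolding beta_pow_eq_1_iff using N_pos two_len[of m] by (auto dest!: dvd_imp_le)
  ultimately show ?thesis by (simp add: power2_eq_1_iff)
qed

end

subsection \<open>The negacyclic code through its zeros\<close>

lemma degree_nega_mod: "0 < n \<Longrightarrow> degree (nega_mod n :: 'f::field poly) = n"
  by (simp add: nega_mod_def degree_add_eq_left degree_monom_eq)

lemma nega_mod_nonzero: "0 < n \<Longrightarrow> (nega_mod n :: 'f::field poly) \<noteq> 0"
  using degree_nega_mod[of n, where 'f = 'f] by auto

lemma mod_nega_mod_less: "0 < n \<Longrightarrow> degree (p mod nega_mod n :: 'f::field poly) < n"
  using degree_mod_less'[OF nega_mod_nonzero, of n p] degree_nega_mod[of n, where 'f = 'f]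
  by (cases "p mod nega_mod n = 0") auto

lemma mod_nega_mod_id: "degree p < n \<Longrightarrow> p mod (nega_mod n :: 'f::field poly) = p"
  using degree_nega_mod[of n, where 'f = 'f] by (intro mod_poly_less) auto

lemma cring_nega_ring:
  assumes "0 < n"
  shows "cring (nega_ring n :: 'f::field poly ring)"
proof (rule cringI)
  show "abelian_group (nega_ring n :: 'f poly ring)"
  proof (rule abelian_groupI)
    fix x :: "'f poly" assume "x \<in> carrier (nega_ring n)"
    then show "\<exists>y\<in>carrier (nega_ring n). y \<oplus>\<^bsub>nega_ring n\<^esub> x = \<zero>\<^bsub>nega_ring n\<^esub>"
      by (intro bexI[of _ "- x"]) (auto simp: nega_ring_def)
  qed (use assms in \<open>auto simp: nega_ring_def intro: degree_add_less\<close>)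
  show "comm_monoid (nega_ring n :: 'f poly ring)"
    by (rule comm_monoidI)
      (use assms in \<open>auto simp: nega_ring_def mod_nega_mod_less mod_nega_mod_id
        mod_mult_left_eq mod_mult_right_eq mult_ac\<close>)
qed (auto simp: nega_ring_def poly_mod_add_left distrib_right)

lemma coeff_word_poly: "coeff (word_poly c) j = (if j < dim_vec c then c $ j else 0)"
  by (auto simp: word_poly_def coeff_sum intro: sum.neutral)

lemma degree_word_poly:
  assumes "c \<in> carrier_vec n" "0 < n"
  shows "degree (word_poly c) < n"
proof -
  have "degree (word_poly c) \<le> n - 1"
    using assms by (intro degree_le) (auto simp: coeff_word_poly)
  then show ?thesis using assms by simp
qed

lemma word_poly_vec: "degree p < n \<Longrightarrow> word_poly (vec n (coeff p)) = p"
  by (rule poly_eqI) (auto simp: coeff_word_poly coeff_eq_0)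

lemma word_poly_vec_image:
  assumes "0 < n"
  shows "word_poly ` {c \<in> carrier_vec n. word_poly c \<in> A} = A \<inter> {p. degree p < n}" (is "?L = ?R")
proof
  show "?L \<subseteq> ?R" using degree_word_poly assms by auto
  show "?R \<subseteq> ?L"
  proof
    fix p assume "p \<in> ?R"
    then show "p \<in> ?L"
      by (intro image_eqI[of _ _ "vec n (coeff p)"]) (auto simp: word_poly_vec)
  qed
qed

text \<open>As \<open>g\<close> divides the modulus, reduction preserves divisibility by
  \<open>g\<close>. Conversely the cofactor of a nonzero \<open>p\<close> has degree at most that of
  \<open>p\<close>, so it is itself a representative.\<close>

lemma PIdl_nega_ring:
  fixes g :: "'f::field poly"
  assumes n: "0 < n" and dvd: "g dvd nega_mod n"
  shows "PIdl\<^bsub>nega_ring n\<^esub> (g mod nega_mod n) = {p. degree p < n \<and> g dvd p}"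
proof -
  have "PIdl\<^bsub>nega_ring n\<^esub> (g mod nega_mod n) = {(x * g) mod nega_mod n | x. degree x < n}"
    by (auto simp: cgenideal_def nega_ring_def mod_mult_right_eq)
  also have "\<dots> = {p. degree p < n \<and> g dvd p}"
  proof (intro equalityI subsetI)
    fix p assume "p \<in> {(x * g) mod nega_mod n | x. degree x < n}"
    then show "p \<in> {p. degree p < n \<and> g dvd p}"
      using dvd n by (auto simp: mod_nega_mod_less dvd_mod_iff)
  next
    fix p assume p: "p \<in> {p. degree p < n \<and> g dvd p}"
    then obtain x where x: "p = x * g" by (metis dvd_div_mult_self mem_Collect_eq)
    show "p \<in> {(x * g) mod nega_mod n | x. degree x < n}"
    proof (cases "p = 0")
      case True then show ?thesis using n by (intro CollectI exI[of _ 0]) auto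
    next
      case False
      then have "degree x \<le> degree p" by (simp add: x degree_mult_eq)
      then show ?thesis using p
        by (intro CollectI exI[of _ x]) (auto simp: x mod_nega_mod_id)
    qed
  qed
  finally show ?thesis .
qed

section \<open>The generator polynomial and its zeros\<close>

context negacyclic_C1 begin

lemma n_pos: "0 < n"
  using N_pos two_len[of m] by simp

definition gen :: "'f poly" where
  "gen = generator_poly \<phi> \<beta> (T1 m)"

text \<open>Cubing is a ring homomorphism that permutes the roots, since the defining set is closed
  under tripling. The coefficients of the product are therefore fixed by cubing and lie in the image
  of \<open>\<phi>\<close>.\<close>

lemma map_poly_gen: "map_poly \<phi> gen = (\<Prod>i\<in>T1 m. [:- (\<beta> ^ i), 1:])"
proof -
  let ?P = "\<Prod>i\<in>T1 m. [:- (\<beta> ^ i), 1:]"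
  interpret cube: idom_hom "\<lambda>x :: 'k. x ^ 3"
    by unfold_locales (auto simp: power_mult_distrib cube_add_char3[OF three_k])
  interpret map_cube: map_poly_idom_hom "\<lambda>x :: 'k. x ^ 3" ..
  let ?t = "\<lambda>h. (3 * h) mod N"
  have inj: "inj_on ?t (T1 m)"
    by (rule inj_on_subset[OF inj_on_triple_mod]) (auto simp: T1_eq)
  moreover have "?t ` T1 m \<subseteq> T1 m" using triple_mod_T1 m_ge_4 by auto
  ultimately have img: "?t ` T1 m = T1 m" by (simp add: endo_inj_surj finite_T1)
  have "map_poly (\<lambda>x. x ^ 3) ?P = (\<Prod>i\<in>T1 m. [:- (\<beta> ^ ?t i), 1:])"
    unfolding beta_pow_mod by (simp add: map_cube.hom_prod power_mult[symmetric] mult.commute)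
  also have "\<dots> = (\<Prod>i\<in>?t ` T1 m. [:- (\<beta> ^ i), 1:])"
    unfolding prod.reindex[OF inj] comp_def ..
  finally have cube_P: "map_poly (\<lambda>x. x ^ 3) ?P = ?P" unfolding img .
  have "coeff ?P i \<in> range \<phi>" for i
    using arg_cong[OF cube_P, of "\<lambda>p. coeff p i"] by (intro cube_fixed_in_range) (simp add: coeff_map_poly)
  moreover have "inv_into UNIV \<phi> 0 = 0" by (metis f_inv_into_f hom_zero injectivity rangeI)
  ultimately have "map_poly \<phi> (map_poly (inv_into UNIV \<phi>) ?P) = ?P"
    by (intro poly_eqI) (simp add: coeff_map_poly f_inv_into_f)
  \<comment> \<open>The description is proper: a preimage was just built, and injectivity of
    \<open>\<phi>\<close> makes it unique.\<close>
  then have "map_poly \<phi> (THE g. map_poly \<phi> g = ?P) = ?P"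
    by (rule theI) (metis \<open>map_poly \<phi> (map_poly (inv_into UNIV \<phi>) ?P) = ?P\<close> map_poly_hom.injectivity)
  then show ?thesis unfolding gen_def generator_poly_def .
qed

lemma degree_gen: "degree gen = card (T1 m)"
proof -
  have "degree (map_poly \<phi> gen) = (\<Sum>i\<in>T1 m. degree [:- (\<beta> ^ i), 1:])"
    unfolding map_poly_gen by (rule degree_prod_eq_sum_degree) simp
  then show ?thesis by simp
qed

lemma gen_nonzero: "gen \<noteq> 0"
proof
  assume "gen = 0"
  then show False using map_poly_gen finite_T1 by (simp add: prod_zero_iff)
qed

text \<open>If \<open>w\<close> vanishes at the prescribed points, so does its remainder modulo
  \<open>gen\<close>. These are \<open>card (T1 m)\<close> distinct points, more than the degree of
  a nonzero remainder allows.\<close>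

lemma gen_dvd_iff: "gen dvd w \<longleftrightarrow> (\<forall>i\<in>T1 m. poly (map_poly \<phi> w) (\<beta> ^ i) = 0)"
proof
  have root: "poly (map_poly \<phi> gen) (\<beta> ^ i) = 0" if "i \<in> T1 m" for i
    unfolding map_poly_gen poly_prod using that finite_T1 by (intro prod_zero) auto
  show "\<forall>i\<in>T1 m. poly (map_poly \<phi> w) (\<beta> ^ i) = 0" if "gen dvd w"
    using that root by (auto elim!: dvdE simp: map_poly_hom.hom_mult)
  assume w: "\<forall>i\<in>T1 m. poly (map_poly \<phi> w) (\<beta> ^ i) = 0"
  define r where "r = w mod gen"
  have wr: "w = gen * (w div gen) + r" by (simp add: r_def)
  have "poly (map_poly \<phi> r) (\<beta> ^ i) = 0" if "i \<in> T1 m" for i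
    using w that root[OF that] arg_cong[OF wr, of "\<lambda>p. poly (map_poly \<phi> p) (\<beta> ^ i)"]
    by (simp add: map_poly_hom.hom_mult map_poly_hom.hom_add)
  then have sub: "(^) \<beta> ` T1 m \<subseteq> {x. poly (map_poly \<phi> r) x = 0}" by auto
  have "inj_on ((^) \<beta>) (T1 m)" by (rule inj_on_subset[OF beta_inj]) (auto simp: T1_eq)
  then have c: "card ((^) \<beta> ` T1 m) = card (T1 m)" by (rule card_image)
  have "r = 0"
  proof (rule ccontr)
    assume r: "r \<noteq> 0"
    then have ne: "map_poly \<phi> r \<noteq> 0" by simp
    have "card (T1 m) \<le> degree (map_poly \<phi> r)"
      using card_mono[OF poly_roots_finite[OF ne] sub] card_poly_roots_bound[OF ne] c by linarith
    then show False using degree_mod_less'[OF gen_nonzero, of w] r by (simp add: r_def degree_gen)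
  qed
  then show "gen dvd w" using r_def by auto
qed

lemma gen_dvd_nega_mod: "gen dvd nega_mod n"
  unfolding gen_dvd_iff
proof
  fix i assume "i \<in> T1 m"
  then have "odd i" by (simp add: T1_eq)
  have "(\<beta> ^ i) ^ n = (\<beta> ^ n) ^ i" by (simp add: power_mult[symmetric] mult.commute)
  then have "(\<beta> ^ i) ^ n = -1" using \<open>odd i\<close> by (simp add: beta_len)
  then show "poly (map_poly \<phi> (nega_mod n)) (\<beta> ^ i) = 0"
    by (simp add: nega_mod_def map_poly_hom.hom_add map_poly_monom poly_monom)
qed

abbreviation "C \<equiv> code_C1 m \<phi> \<beta>"

lemma C_eq_gen_dvd: "C = {c \<in> carrier_vec n. gen dvd word_poly c}"
  using PIdl_nega_ring[OF n_pos gen_dvd_nega_mod] degree_word_poly[OF _ n_pos]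
  by (auto simp: code_C1_def code_of_generator_def simp flip: gen_def)

lemma poly_word_poly:
  assumes "c \<in> carrier_vec n"
  shows "poly (map_poly \<phi> (word_poly c)) x = (\<Sum>j<n. \<phi> (c $ j) * x ^ j)"
  using assms by (simp add: word_poly_def map_poly_hom.hom_sum poly_sum map_poly_monom poly_monom)

lemma C_iff:
  "c \<in> C \<longleftrightarrow> c \<in> carrier_vec n \<and> (\<forall>i\<in>T1 m. (\<Sum>j<n. \<phi> (c $ j) * \<beta> ^ (i * j)) = 0)"
  by (auto simp: C_eq_gen_dvd gen_dvd_iff poly_word_poly power_mult)

lemma C_carrier: "c \<in> C \<Longrightarrow> c \<in> carrier_vec n"
  by (simp add: C_iff)

lemma subspace_C: "linear_code n C"
proof -
  interpret vec_space "TYPE('f)" n .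
  have 0: "0\<^sub>v n \<in> C" by (simp add: C_iff)
  have add: "u + v \<in> C" if "u \<in> C" "v \<in> C" for u v
    using that by (auto simp: C_iff hom_add distrib_right sum.distrib)
  have smult: "a \<cdot>\<^sub>v v \<in> C" if "v \<in> C" for a v
  proof -
    have "(\<Sum>j<n. \<phi> ((a \<cdot>\<^sub>v v) $ j) * \<beta> ^ (i * j)) = \<phi> a * (\<Sum>j<n. \<phi> (v $ j) * \<beta> ^ (i * j))" for i
      using C_carrier[OF that] by (simp add: hom_mult sum_distrib_left mult.assoc)
    then show ?thesis using that by (simp add: C_iff)
  qed
  show ?thesis unfolding linear_code_def
  proof (rule subspace.intro[OF vec_vs], unfold_locales)
  qed (use 0 add smult C_carrier in \<open>auto simp: module_vec_simps\<close>)
qed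

lemma negacyclic_C: "negacyclic n C"
proof -
  interpret cring "nega_ring n :: 'f poly ring" by (rule cring_nega_ring[OF n_pos])
  have "word_poly ` C = PIdl\<^bsub>nega_ring n\<^esub> (gen mod nega_mod n)"
    unfolding code_C1_def code_of_generator_def word_poly_vec_image[OF n_pos] gen_def[symmetric]
    using PIdl_nega_ring[OF n_pos gen_dvd_nega_mod] by auto
  moreover have "gen mod nega_mod n \<in> carrier (nega_ring n)"
    by (simp add: nega_ring_def mod_nega_mod_less n_pos)
  ultimately show ?thesis
    using cgenideal_ideal subspace_C by (simp add: negacyclic_def)
qed

end

subsection \<open>Dimension and self-duality\<close>

lemma sum_lessThan_add:
  "(\<Sum>j<a + b. f j) = (\<Sum>j<a. f j) + (\<Sum>j<b. f (j + a :: nat) :: 'a::comm_monoid_add)"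
  by (induction b) (auto simp: add_ac)

text \<open>Combine the relations with the coefficients of the polynomial \<open>q\<close> that
  vanishes on all of \<open>X\<close> except \<open>y\<close>; its degree is
  \<open>card X - 1\<close>, and only the term at \<open>y\<close> survives.\<close>

lemma vandermonde_kernel:
  fixes a :: "'k::field \<Rightarrow> 'k"
  assumes "finite X" and zero: "\<And>i. i < card X \<Longrightarrow> (\<Sum>x\<in>X. a x * x ^ i) = 0" and "y \<in> X"
  shows "a y = 0"
proof -
  define q where "q = (\<Prod>x\<in>X - {y}. [:- x, 1:])"
  have "degree q = card (X - {y})"
    unfolding q_def by (subst degree_prod_eq_sum_degree) auto
  moreover have "0 < card X" using assms by (auto simp: card_gt_0_iff)
  ultimately have deg: "degree q < card X"
    using assms by simp
  have "(\<Sum>x\<in>X. a x * poly q x) = (\<Sum>i\<le>degree q. coeff q i * (\<Sum>x\<in>X. a x * x ^ i))"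
    unfolding poly_altdef sum_distrib_left by (subst sum.swap) (simp add: mult_ac)
  also have "\<dots> = 0" using zero deg by (intro sum.neutral) auto
  finally have "(\<Sum>x\<in>X. a x * poly q x) = 0" .
  moreover have "(\<Sum>x\<in>X. a x * poly q x) = a y * poly q y"
    using assms by (subst sum.remove[of _ y]) (auto simp: q_def poly_prod prod_zero_iff intro!: sum.neutral)
  moreover have "poly q y \<noteq> 0"
    using assms(1) by (auto simp: q_def poly_prod prod_zero_iff)
  ultimately show ?thesis by simp
qed

section \<open>Both halves of the coordinates are information sets\<close>

context negacyclic_C1 begin

abbreviation "r \<equiv> card (T1 m)"

lemma n_eq: "n = r + r"
  using two_card_T1[OF even_m] by simp

lemma r_pos: "0 < r"
  using n_pos n_eq by simp

text \<open>Codewords agreeing on the upper half differ by a multiple of \<open>gen\<close> of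
  degree below \<open>r = degree gen\<close>, which must be zero.\<close>

lemma C_eqI:
  assumes "c \<in> C" "d \<in> C" and eq: "\<And>j. j < r \<Longrightarrow> c $ (j + r) = d $ (j + r)"
  shows "c = d"
proof -
  let ?w = "word_poly c - word_poly d"
  have car: "c \<in> carrier_vec n" "d \<in> carrier_vec n" using assms C_carrier by auto
  have "gen dvd ?w" using assms by (simp add: C_eq_gen_dvd)
  moreover have "coeff ?w j = 0" if "j \<ge> r" for j
    using that eq[of "j - r"] car n_eq by (auto simp: coeff_word_poly)
  then have "?w \<noteq> 0 \<Longrightarrow> degree ?w < r"
    using leading_coeff_0_iff not_less by blast
  ultimately have "?w = 0" using dvd_imp_degree_le[of gen ?w] degree_gen by fastforce
  then have "coeff (word_poly c) = coeff (word_poly d)" by simp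
  then have "coeff (word_poly c) j = coeff (word_poly d) j" for j by simp
  then show ?thesis using car by (intro eq_vecI) (metis carrier_vecD coeff_word_poly)+
qed

text \<open>Systematic encoding: subtracting the remainder modulo \<open>gen\<close> gives a
  codeword and alters only coordinates below \<open>r\<close>.\<close>

lemma C_exists:
  fixes v :: "nat \<Rightarrow> 'f"
  obtains c where "c \<in> C" "\<And>j. j < r \<Longrightarrow> c $ (j + r) = v j"
proof -
  define V where "V = (\<Sum>j<r. monom (v j) (j + r))"
  define p where "p = V - V mod gen"
  have V: "coeff V (j + r) = v j" if "j < r" for j
    using that by (simp add: V_def coeff_sum)
  have V0: "coeff V j = 0" if "j \<ge> n" for j
    using that by (auto simp: V_def coeff_sum n_eq intro!: sum.neutral)
  have R: "coeff (V mod gen) j = 0" if "j \<ge> r" for j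
    using that degree_mod_less'[OF gen_nonzero, of V] degree_gen by (cases "V mod gen = 0") (auto intro: coeff_eq_0)
  have "degree p \<le> n - 1"
    using V0 R n_eq by (intro degree_le) (auto simp: p_def)
  then have deg: "degree p < n" using n_pos by simp
  have "gen dvd p" by (simp add: p_def dvd_minus_mod)
  show thesis
  proof (rule that)
    show "vec n (coeff p) \<in> C"
      using \<open>gen dvd p\<close> by (simp add: C_eq_gen_dvd word_poly_vec[OF deg])
    show "vec n (coeff p) $ (j + r) = v j" if "j < r" for j
      using that V R n_eq by (simp add: p_def)
  qed
qed

lemma C_exists_low:
  fixes v :: "nat \<Rightarrow> 'f"
  obtains c where "c \<in> C" "\<And>j. j < r \<Longrightarrow> c $ j = v j"
proof -
  obtain d where d: "d \<in> C" "\<And>j. j < r \<Longrightarrow> d $ (j + r) = - v j"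
    using C_exists[of "\<lambda>j. - v j"] by auto
  \<comment> \<open>The negacyclic shift of \<open>d\<close> by \<open>r = n/2\<close> places: it
    swaps the halves and negates the one that wraps around, cancelling the sign put into
    \<open>d\<close>.\<close>
  define c where "c = vec n (\<lambda>j. if j < r then - d $ (j + r) else d $ (j - r))"
  have "(\<Sum>j<n. \<phi> (c $ j) * \<beta> ^ (i * j)) = 0" if i: "i \<in> T1 m" for i
  proof -
    have "odd i" using i by (simp add: T1_eq)
    have "\<beta> ^ (i * r) * \<beta> ^ (i * r) = (\<beta> ^ n) ^ i"
      by (simp add: n_eq algebra_simps flip: power_add power_mult)
    \<comment> \<open>With this square root of -1, the shift multiplies the value at
      \<open>\<beta> ^ i\<close> by \<open>\<beta> ^ (i * r)\<close>, so zeros are kept.\<close>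
    then have z: "\<beta> ^ (i * r) * \<beta> ^ (i * r) = -1" using \<open>odd i\<close> by (simp add: beta_len)
    have "(\<Sum>j<n. \<phi> (c $ j) * \<beta> ^ (i * j)) = (\<Sum>j<r. \<phi> (c $ j) * \<beta> ^ (i * j))
        + (\<Sum>j<r. \<phi> (c $ (j + r)) * \<beta> ^ (i * (j + r)))"
      unfolding n_eq by (rule sum_lessThan_add)
    also have "(\<Sum>j<r. \<phi> (c $ j) * \<beta> ^ (i * j)) = (\<Sum>j<r. - \<phi> (d $ (j + r)) * \<beta> ^ (i * j))"
      by (intro sum.cong) (auto simp: c_def n_eq hom_uminus)
    also have "\<dots> = \<beta> ^ (i * r) * (\<Sum>j<r. \<phi> (d $ (j + r)) * \<beta> ^ (i * (j + r)))"
      unfolding sum_distrib_left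
    proof (rule sum.cong)
      fix j
      have "\<beta> ^ (i * r) * (\<phi> (d $ (j + r)) * \<beta> ^ (i * (j + r)))
          = (\<beta> ^ (i * r) * \<beta> ^ (i * r)) * (\<phi> (d $ (j + r)) * \<beta> ^ (i * j))"
        by (simp add: distrib_left power_add mult_ac)
      then show "- \<phi> (d $ (j + r)) * \<beta> ^ (i * j) = \<beta> ^ (i * r) * (\<phi> (d $ (j + r)) * \<beta> ^ (i * (j + r)))"
        unfolding z by simp
    qed simp
    also have "(\<Sum>j<r. \<phi> (c $ (j + r)) * \<beta> ^ (i * (j + r))) = \<beta> ^ (i * r) * (\<Sum>j<r. \<phi> (d $ j) * \<beta> ^ (i * j))"
      unfolding sum_distrib_left
      by (intro sum.cong) (auto simp: c_def n_eq distrib_left power_add mult_ac)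
    also have "\<beta> ^ (i * r) * (\<Sum>j<r. \<phi> (d $ (j + r)) * \<beta> ^ (i * (j + r)))
        + \<beta> ^ (i * r) * (\<Sum>j<r. \<phi> (d $ j) * \<beta> ^ (i * j)) = \<beta> ^ (i * r) * (\<Sum>j<n. \<phi> (d $ j) * \<beta> ^ (i * j))"
      unfolding n_eq sum_lessThan_add by (simp add: distrib_left add.commute)
    also have "(\<Sum>j<n. \<phi> (d $ j) * \<beta> ^ (i * j)) = 0" using d(1) i by (simp add: C_iff)
    finally show ?thesis by simp
  qed
  then have "c \<in> C" by (simp add: C_iff c_def)
  moreover have "c $ j = v j" if "j < r" for j using that d(2) by (simp add: c_def n_eq)
  ultimately show thesis by (rule that)
qed

text \<open>In characteristic 3 one has \<open>2 * n + 1 = 3 ^ m = 0\<close>, so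
  \<open>n = 0\<close> would force \<open>1 = 0\<close>.\<close>

lemma of_nat_n_nonzero: "of_nat n \<noteq> (0 :: 'k)"
proof
  assume 0: "of_nat n = (0 :: 'k)"
  have "of_nat (2 * n + 1) = (3 :: 'k) ^ m" unfolding two_len by (simp del: of_nat_diff)
  then show False using 0 three_k m_ge_4 by (simp add: power_0_left)
qed

text \<open>With \<open>z = \<beta> ^ j / \<beta> ^ k\<close> the sum over odd exponents is
  \<open>z\<close> times a geometric sum in \<open>z\<^sup>2\<close>. It vanishes for distinct
  \<open>j\<close> and \<open>k\<close>, because their doubles are distinct and below
  \<open>N\<close>.\<close>

lemma sum_Omega:
  assumes "j < n" "k < n"
  shows "(\<Sum>i\<in>Omega m. \<beta> ^ (i * j) * \<beta> ^ ((N - i) * k)) = (if j = k then of_nat n else 0)"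
proof -
  define z where "z = \<beta> ^ j / \<beta> ^ k"
  have z_pow: "\<beta> ^ (i * j) * \<beta> ^ ((N - i) * k) = z ^ i" if "i \<in> Omega m" for i
  proof -
    have "i < N" using that by (simp add: Omega_eq)
    then have "\<beta> ^ ((N - i) * k) * \<beta> ^ (i * k) = (\<beta> ^ N) ^ k"
      by (simp flip: power_add power_mult distrib_right)
    then have "\<beta> ^ ((N - i) * k) = 1 / \<beta> ^ (i * k)"
      using beta_N beta_nonzero by (simp add: field_simps)
    then show ?thesis
      by (simp add: z_def power_divide mult.commute flip: power_mult)
  qed
  have "(\<Sum>i\<in>Omega m. \<beta> ^ (i * j) * \<beta> ^ ((N - i) * k)) = (\<Sum>i\<in>Omega m. z ^ i)"
    using z_pow by (rule sum.cong[OF refl])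
  also have "\<dots> = (\<Sum>i\<in>(\<lambda>t. 1 + 2 * t) ` {..<n}. z ^ i)"
    by (rule arg_cong[of _ _ "sum _"]) (auto simp: Omega_def)
  also have "\<dots> = z * (\<Sum>t<n. (z\<^sup>2) ^ t)"
    by (subst sum.reindex) (auto simp: inj_on_def sum_distrib_left power_mult)
  also have "\<dots> = (if j = k then of_nat n else 0)"
  proof (cases "j = k")
    case True
    then show ?thesis using beta_nonzero by (simp add: z_def)
  next
    case False
    have "z\<^sup>2 \<noteq> 1"
    proof
      assume "z\<^sup>2 = 1"
      then have "\<beta> ^ (2 * j) = \<beta> ^ (2 * k)"
        using beta_nonzero by (simp add: z_def power_divide power_mult[symmetric] mult.commute)
      then have "2 * j = 2 * k"
        using assms two_len[of m] by (intro inj_onD[OF beta_inj]) auto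
      then show False using False by simp
    qed
    moreover have "(z\<^sup>2) ^ n = 1"
    proof -
      have "(z\<^sup>2) ^ n = z ^ N" by (simp only: two_len flip: power_mult)
      also have "\<dots> = (\<beta> ^ N) ^ j / (\<beta> ^ N) ^ k" by (simp add: z_def power_divide mult.commute flip: power_mult)
      finally show ?thesis by (simp only: beta_N power_one div_by_1)
    qed
    ultimately show ?thesis using False by (simp add: geometric_sum)
  qed
  finally show ?thesis .
qed

text \<open>Parseval over the odd exponents: every product in the transform of \<open>u \<bullet> v\<close> vanishes because
  one of \<open>i\<close> and \<open>N - i\<close> lies in the defining set.\<close>
lemma C_self_orthogonal:
  assumes u: "u \<in> C" and v: "v \<in> C"
  shows "u \<bullet> v = 0"
proof -
  let ?U = "\<lambda>i. \<Sum>j<n. \<phi> (u $ j) * \<beta> ^ (i * j)" and ?V = "\<lambda>i. \<Sum>j<n. \<phi> (v $ j) * \<beta> ^ (i * j)"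
  have "?U i * ?V (N - i) = 0" if "i \<in> Omega m" for i
    using complement_T1[OF even_m that] u v by (auto simp: C_iff simp del: One_nat_def)
  then have "0 = (\<Sum>i\<in>Omega m. ?U i * ?V (N - i))" by simp
  also have "\<dots> = (\<Sum>i\<in>Omega m. \<Sum>j<n. \<Sum>k<n. \<phi> (u $ j) * \<phi> (v $ k) * (\<beta> ^ (i * j) * \<beta> ^ ((N - i) * k)))"
    unfolding sum_product by (intro sum.cong refl) (simp only: mult_ac)
  also have "\<dots> = (\<Sum>j<n. \<Sum>i\<in>Omega m. \<Sum>k<n. \<phi> (u $ j) * \<phi> (v $ k) * (\<beta> ^ (i * j) * \<beta> ^ ((N - i) * k)))"
    by (rule sum.swap)
  also have "\<dots> = (\<Sum>j<n. \<Sum>k<n. \<Sum>i\<in>Omega m. \<phi> (u $ j) * \<phi> (v $ k) * (\<beta> ^ (i * j) * \<beta> ^ ((N - i) * k)))"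
    by (intro sum.cong refl sum.swap)
  also have "\<dots> = (\<Sum>j<n. \<Sum>k<n. \<phi> (u $ j) * \<phi> (v $ k) * (if j = k then of_nat n else 0))"
    unfolding sum_distrib_left[symmetric] by (intro sum.cong refl) (simp only: sum_Omega lessThan_iff)
  also have "\<dots> = (\<Sum>j<n. \<phi> (u $ j) * \<phi> (v $ j)) * of_nat n"
    by (simp add: sum_distrib_right if_distrib[of "(*) _"] cong: if_cong)
  also have "(\<Sum>j<n. \<phi> (u $ j) * \<phi> (v $ j)) = \<phi> (u \<bullet> v)"
    using C_carrier[OF v] by (simp add: scalar_prod_def hom_sum hom_mult atLeast0LessThan)
  finally show ?thesis using of_nat_n_nonzero by simp
qed

lemma C_minus:
  assumes "u \<in> C" "v \<in> C"
  shows "u - v \<in> C"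
  using assms by (auto simp: C_iff hom_minus left_diff_distrib sum_subtractf)

text \<open>For the harder inclusion, take a codeword \<open>c\<close> agreeing with
  \<open>u\<close> on the upper half. Both are orthogonal to the code, and pairing
  \<open>u - c\<close> with codewords whose lower half is a unit vector shows agreement on the lower
  half.\<close>

lemma dual_C: "dual_code n C = C"
proof
  show "C \<subseteq> dual_code n C"
    using C_self_orthogonal C_carrier by (auto simp: dual_code_def)
  show "dual_code n C \<subseteq> C"
  proof
    fix u assume "u \<in> dual_code n C"
    then have u: "u \<in> carrier_vec n" "\<And>v. v \<in> C \<Longrightarrow> u \<bullet> v = 0" by (auto simp: dual_code_def)
    obtain c where c: "c \<in> C" "\<And>j. j < r \<Longrightarrow> c $ (j + r) = u $ (j + r)"
      using C_exists[of "\<lambda>j. u $ (j + r)"] by auto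
    have "u $ j = c $ j" if "j < r" for j
    proof -
      obtain e where e: "e \<in> C" "\<And>k. k < r \<Longrightarrow> e $ k = (if k = j then 1 else 0)"
        using C_exists_low[of "\<lambda>k. if k = j then 1 else 0"] by auto
      have "0 = u \<bullet> e - c \<bullet> e" using u(2) e(1) c(1) C_self_orthogonal by simp
      also have "\<dots> = (\<Sum>k<r + r. (u $ k - c $ k) * e $ k)"
        using C_carrier[OF e(1)] by (simp add: scalar_prod_def n_eq atLeast0LessThan sum_subtractf left_diff_distrib)
      also have "\<dots> = (\<Sum>k<r. (u $ k - c $ k) * (if k = j then 1 else 0))"
        unfolding sum_lessThan_add using e(2) c(2) by simp
      also have "\<dots> = u $ j - c $ j" using that by (simp add: if_distrib[of "(*) _"] cong: if_cong)
      finally show ?thesis by simp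
    qed
    then have "u $ j = c $ j" if "j < n" for j
      using that c(2)[of "j - r"] n_eq by (cases "j < r") auto
    then have "u = c" using u(1) C_carrier[OF c(1)] by (intro eq_vecI) auto
    then show "u \<in> C" using c(1) by simp
  qed
qed

text \<open>Projection to the last \<open>r\<close> coordinates is a linear bijection from the code
  onto \<open>carrier_vec r\<close>.\<close>

lemma dim_C: "code_dim n C = r"
proof -
  interpret V: vectorspace class_ring "(module_vec TYPE('f) n)\<lparr>carrier := C\<rparr>"
    using vectorspace.subspace_is_vs[OF vec_vs] subspace_C unfolding linear_code_def by blast
  interpret W: vec_space "TYPE('f)" r .
  have dim_vec_C: "dim_vec c = r + r" if "c \<in> C" for c
    using C_carrier[OF that] n_eq by simp
  define f where "f = (\<lambda>c :: 'f vec. vec r (\<lambda>j. c $ (j + r)))"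
  have hom: "f \<in> LinearCombinations.module_hom class_ring ((module_vec TYPE('f) n)\<lparr>carrier := C\<rparr>) (module_vec TYPE('f) r)"
    using dim_vec_C by (auto simp: LinearCombinations.module_hom_def module_vec_simps f_def intro!: eq_vecI)
  interpret linear_map class_ring "(module_vec TYPE('f) n)\<lparr>carrier := C\<rparr>" "module_vec TYPE('f) r" f
    by unfold_locales (rule hom)
  have "finite (carrier_vec n :: 'f vec set)"
  proof (rule finite_subset)
    show "carrier_vec n \<subseteq> vec_of_list ` {xs. set xs \<subseteq> (UNIV :: 'f set) \<and> length xs = n}"
      by (metis (mono_tags, lifting) carrier_vecD image_eqI length_list_of_vec mem_Collect_eq subsetI
          subset_UNIV vec_list)
  qed (rule finite_imageI[OF finite_lists_length_eq[OF finite_f]])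
  then have "finite C" by (rule finite_subset[rotated]) (use C_carrier in auto)
  then have "V.fin_dim"
    unfolding V.fin_dim_def using V.in_own_span[of C] V.span_is_subset2[of C] by auto
  moreover have "inj_on f C"
  proof (rule inj_onI)
    fix c d assume cd: "c \<in> C" "d \<in> C" "f c = f d"
    have "c $ (j + r) = d $ (j + r)" if "j < r" for j
      using arg_cong[OF cd(3), of "\<lambda>v. v $ j"] that by (simp add: f_def)
    then show "c = d" using cd by (intro C_eqI) auto
  qed
  moreover have "f ` C = carrier_vec r"
  proof
    show "carrier_vec r \<subseteq> f ` C"
    proof
      fix v :: "'f vec" assume v: "v \<in> carrier_vec r"
      obtain c where "c \<in> C" "\<And>j. j < r \<Longrightarrow> c $ (j + r) = v $ j" using C_exists[of "\<lambda>j. v $ j"] by auto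
      then show "v \<in> f ` C" using v by (intro image_eqI[of _ _ c]) (auto simp: f_def)
    qed
  qed (auto simp: f_def)
  ultimately have "V.dim = W.dim" using dim_eq by (simp add: module_vec_simps)
  then show ?thesis by (simp add: code_dim_def W.dim_is_n)
qed

end

subsection \<open>Minimum distance\<close>

text \<open>Modulo the step \<open>3 ^ k + 1\<close> the number \<open>3 ^ (2 * k + 2) - 1\<close>
  is congruent to 8, so their gcd divides 8. The step is 2 or 4 modulo 8, which leaves a divisor of
  4.\<close>

lemma progression_step_dvd:
  fixes k d :: nat
  assumes "3 ^ (2 * k + 2) - 1 dvd (3 ^ k + 1) * d"
  shows "3 ^ (2 * k + 2) - 1 dvd 4 * d"
proof -
  let ?N = "3 ^ (2 * k + 2) - 1 :: nat" and ?s = "3 ^ k + 1 :: nat"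
  define g where "g = gcd ?N ?s"
  have "g dvd ?s * (9 * (3 ^ k - 1))"
    unfolding g_def by (intro dvd_mult2 gcd_dvd2)
  moreover have "?N = ?s * (9 * (3 ^ k - 1)) + 8"
  proof -
    obtain t :: nat where "3 ^ k = t + 1" using not0_implies_Suc[of "3 ^ k :: nat"] by auto
    moreover have "3 ^ (2 * k + 2) = 9 * (3 ^ k * 3 ^ k :: nat)" by (simp add: power_add mult_2)
    ultimately show ?thesis by (simp add: algebra_simps)
  qed
  moreover have "g dvd ?N" by (simp add: g_def)
  ultimately have g8: "g dvd 8" by (metis dvd_add_right_iff)
  have "3 ^ k mod 8 = (1 :: nat) \<or> 3 ^ k mod 8 = (3 :: nat)"
  proof (induction k)
    case (Suc k)
    have "3 ^ Suc k mod 8 = 3 * (3 ^ k mod 8) mod (8 :: nat)" by (simp add: mod_mult_right_eq)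
    with Suc show ?case by auto
  qed simp
  then have "\<not> 8 dvd ?s" by presburger
  moreover have "g dvd ?s" by (simp add: g_def)
  ultimately have "g \<noteq> 8" by auto
  have "g dvd 4"
  proof -
    have "g dvd 2 ^ 3" using g8 by simp
    then obtain i where "i \<le> 3" "g = 2 ^ i"
      using divides_primepow_nat[OF two_is_prime_nat, of g 3] by blast
    moreover from this have "i \<le> 2" using \<open>g \<noteq> 8\<close> by (cases "i = 3") auto
    ultimately have "g dvd 2 ^ 2" by (simp only: le_imp_power_dvd)
    then show ?thesis by simp
  qed
  have "?N dvd gcd (?N * d) (?s * d)" using assms by simp
  then have "?N dvd g * d" by (simp add: g_def gcd_mult_distrib_nat mult.commute[of _ d])
  then show ?thesis using \<open>g dvd 4\<close> by (meson dvd_refl dvd_trans mult_dvd_mono)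
qed

definition hamming_weight :: "'f::zero vec \<Rightarrow> nat" where
  "hamming_weight c = card {j. j < dim_vec c \<and> c $ j \<noteq> 0}"

context negacyclic_C1 begin

lemma three_dvd_weight:
  assumes "c \<in> C"
  shows "3 dvd hamming_weight c"
proof -
  have "0 = (\<Sum>j\<in>{0..<dim_vec c}. c $ j * c $ j)"
    using C_self_orthogonal[OF assms assms] by (simp add: scalar_prod_def)
  also have "\<dots> = (\<Sum>j\<in>{0..<dim_vec c}. if c $ j \<noteq> 0 then 1 else 0)"
    by (intro sum.cong refl) (simp add: f_square)
  also have "\<dots> = of_nat (card {j \<in> {0..<dim_vec c}. c $ j \<noteq> 0})"
    by (subst sum.inter_filter[symmetric]) auto
  finally have "of_nat (hamming_weight c) = (0 :: 'f)"
    by (simp add: hamming_weight_def)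
  then show ?thesis by (rule of_nat_f_eq_0)
qed

text \<open>The BCH bound, also for a step \<open>s\<close> whose map \<open>j \<mapsto> \<beta>\<^sup>s\<^sup>j\<close> identifies positions at
  distance \<open>n/2\<close>: the two coefficients combine to \<open>c\<^sub>j + \<iota> c\<^sub>j\<^sub>+\<^sub>n\<^sub>/\<^sub>2\<close> with \<open>\<iota>\<^sup>2 = -1\<close>, which is
  nonzero because \<open>-1\<close> is not a square in the field of three elements.\<close>
lemma folded_BCH_bound:
  assumes c: "c \<in> C" "c \<noteq> 0\<^sub>v n"
    and "odd b" and T: "\<And>i. i < \<delta> \<Longrightarrow> (b + i * s) mod N \<in> T1 m"
    and step: "\<And>d. 0 < d \<Longrightarrow> d < n \<Longrightarrow> N dvd s * d \<Longrightarrow> d = r"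
  shows "\<delta> < hamming_weight c"
proof (rule ccontr)
  assume "\<not> \<delta> < hamming_weight c"
  then have le: "hamming_weight c \<le> \<delta>" by simp
  define S where "S = {j. j < n \<and> c $ j \<noteq> 0}"
  have car: "c \<in> carrier_vec n" using C_carrier[OF c(1)] .
  have finS: "finite S" by (simp add: S_def)
  have cardS: "card S \<le> \<delta>" using le car by (simp add: hamming_weight_def S_def)
  have "S \<noteq> {}"
  proof
    assume "S = {}"
    then have "c = 0\<^sub>v n" using car by (intro eq_vecI) (auto simp: S_def)
    then show False using c(2) by simp
  qed
  define x where "x j = \<beta> ^ (s * j)" for j
  \<comment> \<open>Positions with the same locator \<open>y\<close> are merged, so the Vandermonde
    argument applies to distinct locators.\<close>
  define a where "a y = (\<Sum>j\<in>{j \<in> S. x j = y}. \<phi> (c $ j) * \<beta> ^ (b * j))" for y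
  have zero: "(\<Sum>y\<in>x ` S. a y * y ^ i) = 0" if "i < card (x ` S)" for i
  proof -
    have "i < \<delta>" using that card_image_le[OF finS, of x] cardS by linarith
    have pow: "\<beta> ^ (((b + i * s) mod N) * j) = \<beta> ^ (b * j) * x j ^ i" for j
    proof -
      have "(b + i * s) * j = b * j + s * j * i" by (simp add: algebra_simps)
      moreover have "\<beta> ^ (((b + i * s) mod N) * j) = \<beta> ^ ((b + i * s) * j)"
        by (simp only: power_mult beta_pow_mod)
      ultimately show ?thesis by (simp only: x_def power_add power_mult)
    qed
    have "(\<Sum>y\<in>x ` S. a y * y ^ i) = (\<Sum>y\<in>x ` S. \<Sum>j\<in>{j \<in> S. x j = y}. \<phi> (c $ j) * (\<beta> ^ (b * j) * x j ^ i))"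
      unfolding a_def sum_distrib_right by (intro sum.cong) (auto simp: mult_ac)
    also have "\<dots> = (\<Sum>j\<in>S. \<phi> (c $ j) * (\<beta> ^ (b * j) * x j ^ i))"
      by (rule sum.image_gen[OF finS, symmetric])
    also have "\<dots> = (\<Sum>j<n. \<phi> (c $ j) * \<beta> ^ (((b + i * s) mod N) * j))"
      unfolding pow by (rule sum.mono_neutral_left) (auto simp: S_def)
    also have "\<dots> = 0" using c(1) T[OF \<open>i < \<delta>\<close>] by (simp only: C_iff)
    finally show ?thesis .
  qed
  \<comment> \<open>Starting from the least support position, another position in its fibre can only
    be \<open>j0 + r\<close>.\<close>
  define j0 where "j0 = Min S"
  have j0: "j0 \<in> S" "\<And>j. j \<in> S \<Longrightarrow> j0 \<le> j" using finS \<open>S \<noteq> {}\<close> by (auto simp: j0_def)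
  have a0: "a (x j0) = 0"
    by (rule vandermonde_kernel[of "x ` S"]) (use zero finS j0 in auto)
  have fibre: "j = j0 + r" if "j \<in> S" "x j = x j0" "j \<noteq> j0" for j
  proof -
    have lt: "j0 < j" "j < n" using j0(2)[OF that(1)] that by (auto simp: S_def)
    then have "\<beta> ^ (s * j0) * \<beta> ^ (s * (j - j0)) = \<beta> ^ (s * j0) * 1"
      using that(2) by (simp add: x_def flip: power_add distrib_left)
    then have "N dvd s * (j - j0)" using beta_nonzero beta_pow_eq_1_iff by simp
    then have "j - j0 = r" using lt by (intro step) auto
    then show ?thesis using lt by simp
  qed
  show False
  proof (cases "j0 + r \<in> S \<and> x (j0 + r) = x j0")
    case False
    then have "{j \<in> S. x j = x j0} = {j0}" using fibre j0(1) by auto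
    then show False using a0 j0(1) beta_nonzero by (simp add: a_def S_def)
  next
    case True
    then have F: "{j \<in> S. x j = x j0} = {j0, j0 + r}" using fibre j0(1) by auto
    define \<iota> where "\<iota> = \<beta> ^ (b * r)"
    have "\<iota> * \<iota> = (\<beta> ^ n) ^ b"
      by (simp add: \<iota>_def n_eq algebra_simps flip: power_add power_mult)
    then have \<iota>: "\<iota> * \<iota> = -1" using \<open>odd b\<close> by (simp add: beta_len)
    have "\<beta> ^ (b * j0) * (\<phi> (c $ j0) + \<phi> (c $ (j0 + r)) * \<iota>) = 0"
      using a0 r_pos by (simp add: a_def F \<iota>_def distrib_left power_add mult_ac)
    then have "\<phi> (c $ j0) = - (\<phi> (c $ (j0 + r)) * \<iota>)"
      using beta_nonzero by (simp add: eq_neg_iff_add_eq_0)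
    then have "\<phi> (c $ j0) * \<phi> (c $ j0) = \<phi> (c $ (j0 + r)) * \<phi> (c $ (j0 + r)) * (\<iota> * \<iota>)"
      by simp
    then have "\<phi> (c $ j0 * c $ j0) = - \<phi> (c $ (j0 + r) * c $ (j0 + r))"
      unfolding \<iota> by (simp add: hom_mult)
    then have "(1 :: 'k) = -1"
      using j0(1) True by (simp add: f_square S_def)
    then show False using one_neq_minus_one_char3[OF three_k] by simp
  qed
qed

lemma weight_bound:
  assumes c: "c \<in> C" "c \<noteq> 0\<^sub>v n"
  shows "d_bound m \<le> real (hamming_weight c)"
proof (cases "m = 4")
  case True
  have "(8 :: nat) < hamming_weight c"
  proof (rule folded_BCH_bound[OF c, where b = 47 and s = 14])
    show "(47 + i * 14) mod N \<in> T1 m" if "i < 8" for i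
      using T1_4_progression[OF that] by (simp add: True)
    \<comment> \<open>Since 14 and 80 have gcd 2, \<open>d\<close> would be a multiple of 40: here
      no positions are identified.\<close>
    fix d assume "0 < d" "d < n" "N dvd 14 * d"
    then have "80 dvd 14 * d" "d < 40" by (simp_all add: True len_def)
    then have False using \<open>0 < d\<close> by presburger
    then show "d = r" ..
  qed simp
  then show ?thesis by (simp add: d_bound_def True)
next
  case False
  define k where "k = (m - 2) div 2"
  have m: "m = 2 * k + 2" and k: "2 \<le> k"
    using m_ge_4 even_m False by (auto simp: k_def elim!: evenE)
  have "(3 :: nat) ^ k < hamming_weight c"
  proof (rule folded_BCH_bound[OF c, where b = "3 ^ (2 * k)" and s = "3 ^ k + 1"])
    fix i :: nat assume "i < 3 ^ k"
    then have "3 ^ (2 * k) + i * (3 ^ k + 1) \<in> T1 m" by (rule T1_progression[OF m])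
    moreover from this have "3 ^ (2 * k) + i * (3 ^ k + 1) < N" by (simp only: T1_eq mem_Collect_eq)
    ultimately show "(3 ^ (2 * k) + i * (3 ^ k + 1)) mod N \<in> T1 m" by (simp only: mod_less)
  next
    fix d assume d: "0 < d" "d < n" "N dvd (3 ^ k + 1) * d"
    have N4: "N = 4 * r" using two_len[of m] n_eq by simp
    have "N dvd 4 * d" using progression_step_dvd d(3) unfolding m .
    then have "r dvd d" unfolding N4 by simp
    then obtain t where t: "d = r * t" ..
    \<comment> \<open>A multiple of \<open>r\<close> strictly between 0 and \<open>n = 2 * r\<close>
      is \<open>r\<close> itself.\<close>
    have "\<not> 2 \<le> t" using mult_le_mono2[of 2 t r] d(2) n_eq t by linarith
    moreover have "0 < t" using d(1) t by simp
    ultimately have "t = 1" by simp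
    then show "d = r" using t by simp
  qed simp
  moreover have "3 dvd hamming_weight c" by (rule three_dvd_weight[OF c(1)])
  moreover have "3 dvd (3 :: nat) ^ k" using k by (simp add: dvd_power)
  \<comment> \<open>The weight exceeds \<open>3 ^ k\<close> and both are multiples of 3.\<close>
  ultimately have "3 ^ k + 3 \<le> hamming_weight c"
    by (auto elim!: dvdE)
  then have w: "3 ^ k + 3 \<le> real (hamming_weight c)"
    by (metis of_nat_add of_nat_le_iff of_nat_numeral of_nat_power)
  \<comment> \<open>Exactly what \<open>(3 ^ k + 15) / 2 \<le> 3 ^ k + 3\<close> requires.\<close>
  have "(9 :: real) \<le> 3 ^ k" using power_increasing[OF k, of "3 :: real"] by simp
  then show ?thesis using w by (simp add: d_bound_def flip: k_def)
qed

lemma min_dist_bound: "d_bound m \<le> real (min_dist C)"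
proof -
  let ?D = "{hamming_dist u v | u v. u \<in> C \<and> v \<in> C \<and> u \<noteq> v}"
  \<comment> \<open>A nonzero codeword makes the set of distances nonempty, so its infimum is
    attained.\<close>
  obtain e where e: "e \<in> C" "\<And>j. j < r \<Longrightarrow> e $ j = 1" using C_exists_low[of "\<lambda>_. 1"] by auto
  have zero: "0\<^sub>v n \<in> C" using C_minus[OF e(1) e(1)] C_carrier[OF e(1)] by simp
  have "e \<noteq> 0\<^sub>v n" using e(2)[OF r_pos] r_pos n_eq by auto
  then have "?D \<noteq> {}" using e(1) zero by blast
  then have "min_dist C \<in> ?D" unfolding min_dist_def by (rule Inf_nat_def1)
  then obtain u v where uv: "u \<in> C" "v \<in> C" "u \<noteq> v" and d: "min_dist C = hamming_dist u v" by blast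
  have car: "u \<in> carrier_vec n" "v \<in> carrier_vec n" using uv C_carrier by auto
  have "hamming_dist u v = hamming_weight (u - v)"
    unfolding hamming_dist_def hamming_weight_def using car by (intro arg_cong[of _ _ card]) auto
  moreover have "u - v \<noteq> 0\<^sub>v n"
  proof
    assume "u - v = 0\<^sub>v n"
    then have "(u - v) $ j = 0" if "j < n" for j using that by simp
    then have "u = v" using car by (intro eq_vecI) auto
    then show False using uv(3) by simp
  qed
  ultimately show ?thesis using weight_bound[OF C_minus[OF uv(1,2)]] d by simp
qed

end

theorem theorem11:
  fixes m :: nat and \<phi> :: "'f::field \<Rightarrow> 'k::field" and \<beta> :: 'k
  assumes "CARD('f) = 3" and "CARD('k) = 3 ^ m" and "field_hom \<phi>"
    and "primitive_element \<beta>"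
    and "m \<ge> 4" and "even m"
  shows "negacyclic (len m) (code_C1 m \<phi> \<beta>)
    \<and> dual_code (len m) (code_C1 m \<phi> \<beta>) = code_C1 m \<phi> \<beta>
    \<and> real (code_dim (len m) (code_C1 m \<phi> \<beta>)) = (3 ^ m - 1) / 4
    \<and> real (min_dist (code_C1 m \<phi> \<beta>)) \<ge> d_bound m"
proof -
  interpret negacyclic_C1 m \<phi> \<beta>
    using assms by (rule negacyclic_C1.intro)
  have "4 * r + 1 = 3 ^ m" using two_len[of m] n_eq N_pos by simp
  then have "real (4 * r + 1) = real (3 ^ m)" by (simp only:)
  then show ?thesis using negacyclic_C dual_C dim_C min_dist_bound by simp
qed

end
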